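(* Let $\mathbb{P}_{ns}$ be the set of non-standard probability assignments and $\mathbb{P}_4$ the set of four-valued probability assignments on $\mathcal{L}$. For $\hat p\in\mathbb{P}_4$ with $\hat p(\varphi)=(b_\varphi,d_\varphi,u_\varphi,c_\varphi)$ define $tr_{ns}^4(\hat p):\mathcal{L}\to\mathbb{R}$ by $$tr_{ns}^4(\hat p)(\varphi)=b_\varphi+c_\varphi ,$$ and for $p\in\mathbb{P}_{ns}$ define $tr_4^{ns}(p):\mathcal{L}\to\mathbb{R}^4$ by $$tr_4^{ns}(p)(\varphi)=\bigl(p(\varphi)-p(\varphi\wedge\neg\varphi),\;p(\neg\varphi)-p(\varphi\wedge\neg\varphi),\;1-p(\varphi)-p(\neg\varphi)+p(\varphi\wedge\neg\varphi),\;p(\varphi\wedge\neg\varphi)\bigr).$$ Then these are well-defined maps $tr_{ns}^4:\mathbb{P}_4\to\mathbb{P}_{ns}$ and $tr_4^{ns}:\mathbb{P}_{ns}\to\mathbb{P}_4$ (that is, $tr_{ns}^4(\hat p)\in\mathbb{P}_{ns}$ for every $\hat p\in\mathbb{P}_4$ and $tr_4^{ns}(p)\in\mathbb{P}_4$ for every $p\in\mathbb{P}_{ns}$), and moreover $tr_4^{ns}\circ tr_{ns}^4=\mathrm{id}_{\mathbb{P}_4}$ and $tr_{ns}^4\circ tr_4^{ns}=\mathrm{id}_{\mathbb{P}_{ns}}$.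
   Context: Let $\mathrm{Prop}$ be a fixed finite set of propositional variables and let $\mathcal{L}$ be the set of formulas generated by $\varphi::= p\mid\neg\varphi\mid\varphi\wedge\varphi$ with $p\in\mathrm{Prop}$; $\varphi\vee\psi$ abbreviates $\neg(\neg\varphi\wedge\neg\psi)$. Belnap-Dunn entailment (first degree entailment): a double valuation is a pair of functions $v^+,v^-:\mathrm{Prop}\to\{0,1\}$ (arbitrary and independent of each other), extended to $\mathcal{L}$ by: $v^+(\neg\varphi)=1$ iff $v^-(\varphi)=1$; $v^-(\neg\varphi)=1$ iff $v^+(\varphi)=1$; $v^+(\varphi\wedge\psi)=1$ iff $v^+(\varphi)=1$ and $v^+(\psi)=1$; $v^-(\varphi\wedge\psi)=1$ iff $v^-(\varphi)=1$ or $v^-(\psi)=1$. Write $\varphi\vDash_L\psi$ iff for all double valuations, $v^+(\varphi)=1$ implies $v^+(\psi)=1$. A non-standard probability assignment is a function $p:\mathcal{L}\to\mathbb{R}$ such that for all $\varphi,\psi\in\mathcal{L}$: (A1) $0\le p(\varphi)\le 1$; (A2) if $\varphi\vDash_L\psi$ then $p(\varphi)\le p(\psi)$; (A3) $p(\varphi\wedge\psi)+p(\varphi\vee\psi)=p(\varphi)+p(\psi)$. A four-valued probability assignment is a function $\hat p:\mathcal{L}\to\mathbb{R}^4$ such that, writing $\hat p(\varphi)=(b_\varphi,d_\varphi,u_\varphi,c_\varphi)$, for all $\varphi,\psi\in\mathcal{L}$: (D1) $0\le b_\varphi,d_\varphi,u_\varphi,c_\varphi$; (D2) $b_\varphi+d_\varphi+u_\varphi+c_\varphi=1$;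 (D3) $b_{\neg\varphi}=d_\varphi$ and $c_{\neg\varphi}=c_\varphi$; (D4) if $\varphi\vDash_L\psi$ then $b_\varphi+c_\varphi\le b_\psi+c_\psi$; (D5) $b_{\varphi\wedge\neg\varphi}=0$ and $c_{\varphi\wedge\neg\varphi}=c_\varphi$; (D6) $b_\varphi+c_\varphi+b_\psi+c_\psi=b_{\varphi\wedge\psi}+c_{\varphi\wedge\psi}+b_{\varphi\vee\psi}+c_{\varphi\vee\psi}$. *)

theory Defs
  imports "HOL-Analysis.Analysis"
begin

datatype 'p form = Var 'p | Neg "'p form" | Conj "'p form" "'p form"

abbreviation Disj :: "'p form \<Rightarrow> 'p form \<Rightarrow> 'p form" where
  "Disj \<phi> \<psi> \<equiv> Neg (Conj (Neg \<phi>) (Neg \<psi>))"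

(* Positive and negative support under the double valuation (vp, vn); truth values 1, 0 are
   rendered as True, False. *)
fun pos :: "('p \<Rightarrow> bool) \<Rightarrow> ('p \<Rightarrow> bool) \<Rightarrow> 'p form \<Rightarrow> bool"
  and neg :: "('p \<Rightarrow> bool) \<Rightarrow> ('p \<Rightarrow> bool) \<Rightarrow> 'p form \<Rightarrow> bool" where
  "pos vp vn (Var x) \<longleftrightarrow> vp x"
| "pos vp vn (Neg \<phi>) \<longleftrightarrow> neg vp vn \<phi>"
| "pos vp vn (Conj \<phi> \<psi>) \<longleftrightarrow> pos vp vn \<phi> \<and> pos vp vn \<psi>"
| "neg vp vn (Var x) \<longleftrightarrow> vn x"
| "neg vp vn (Neg \<phi>) \<longleftrightarrow> pos vp vn \<phi>"
| "neg vp vn (Conj \<phi> \<psi>) \<longleftrightarrow> neg vp vn \<phi> \<or> neg vp vn \<psi>"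

definition entails :: "'p form \<Rightarrow> 'p form \<Rightarrow> bool" (infix \<open>\<Turnstile>\<^sub>L\<close> 50) where
  "\<phi> \<Turnstile>\<^sub>L \<psi> \<longleftrightarrow> (\<forall>vp vn. pos vp vn \<phi> \<longrightarrow> pos vp vn \<psi>)"

definition P_ns :: "('p form \<Rightarrow> real) set" where
  "P_ns = {p.
     (\<forall>\<phi>. 0 \<le> p \<phi> \<and> p \<phi> \<le> 1) \<and>
     (\<forall>\<phi> \<psi>. \<phi> \<Turnstile>\<^sub>L \<psi> \<longrightarrow> p \<phi> \<le> p \<psi>) \<and>
     (\<forall>\<phi> \<psi>. p (Conj \<phi> \<psi>) + p (Disj \<phi> \<psi>) = p \<phi> + p \<psi>)}"

(* The components 1, 2, 3, 4 of a vector in R^4 are b (belief), d (disbelief),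
   u (uncertainty) and c (conflict). *)
definition P_4 :: "('p form \<Rightarrow> real ^ 4) set" where
  "P_4 = {q.
     let b = (\<lambda>\<phi>. q \<phi> $ 1); d = (\<lambda>\<phi>. q \<phi> $ 2); u = (\<lambda>\<phi>. q \<phi> $ 3); c = (\<lambda>\<phi>. q \<phi> $ 4) in
     (\<forall>\<phi>. 0 \<le> b \<phi> \<and> 0 \<le> d \<phi> \<and> 0 \<le> u \<phi> \<and> 0 \<le> c \<phi>) \<and>
     (\<forall>\<phi>. b \<phi> + d \<phi> + u \<phi> + c \<phi> = 1) \<and>
     (\<forall>\<phi>. b (Neg \<phi>) = d \<phi> \<and> c (Neg \<phi>) = c \<phi>) \<and>
     (\<forall>\<phi> \<psi>. \<phi> \<Turnstile>\<^sub>L \<psi> \<longrightarrow> b \<phi> + c \<phi> \<le> b \<psi> + c \<psi>) \<and>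
     (\<forall>\<phi>. b (Conj \<phi> (Neg \<phi>)) = 0 \<and> c (Conj \<phi> (Neg \<phi>)) = c \<phi>) \<and>
     (\<forall>\<phi> \<psi>. b \<phi> + c \<phi> + b \<psi> + c \<psi>
        = b (Conj \<phi> \<psi>) + c (Conj \<phi> \<psi>) + b (Disj \<phi> \<psi>) + c (Disj \<phi> \<psi>))}"

definition tr_ns_of_4 :: "('p form \<Rightarrow> real ^ 4) \<Rightarrow> 'p form \<Rightarrow> real" where
  "tr_ns_of_4 q = (\<lambda>\<phi>. q \<phi> $ 1 + q \<phi> $ 4)"

definition tr_4_of_ns :: "('p form \<Rightarrow> real) \<Rightarrow> 'p form \<Rightarrow> real ^ 4" where
  "tr_4_of_ns p = (\<lambda>\<phi>. vector
     [p \<phi> - p (Conj \<phi> (Neg \<phi>)),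
      p (Neg \<phi>) - p (Conj \<phi> (Neg \<phi>)),
      1 - p \<phi> - p (Neg \<phi>) + p (Conj \<phi> (Neg \<phi>)),
      p (Conj \<phi> (Neg \<phi>))])"

end

theory Submission
  imports Defs
begin

text \<open>
  The translations are linear changes of coordinates, inverse to each other because \<open>c \<phi>\<close> is the
  probability of the contradiction \<open>\<phi> \<and> \<not>\<phi>\<close>. For a four-valued assignment this is what the
  conditions on \<open>\<phi> \<and> \<not>\<phi>\<close> express: there \<open>b + c\<close> takes the value \<open>0 + c \<phi>\<close>. Hence \<open>b \<phi>\<close> is
  recovered by subtracting it from the probability of \<open>\<phi>\<close>, next \<open>d \<phi> = b (\<not>\<phi>)\<close> by subtracting it
  from the probability of \<open>\<not>\<phi>\<close>, and \<open>u \<phi>\<close> by normalisation.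

  When a non-standard probability is translated, \<open>b\<close> and \<open>d\<close> are non-negative because \<open>\<phi> \<and> \<not>\<phi>\<close>
  entails both \<open>\<phi>\<close> and \<open>\<not>\<phi>\<close>. By inclusion-exclusion, \<open>u\<close> is the complement of the probability of
  \<open>\<phi> \<or> \<not>\<phi>\<close>, which is at most one (and may be smaller, as \<open>\<phi> \<or> \<not>\<phi>\<close> is not valid in Belnap-Dunn
  logic). The conditions on negations and contradictions hold because equivalent formulas have
  equal probability: \<open>\<phi>\<close> is equivalent to \<open>\<not>\<not>\<phi>\<close>, and the contradictions built from \<open>\<not>\<phi>\<close> and from
  \<open>\<phi> \<and> \<not>\<phi>\<close> are equivalent to the one built from \<open>\<phi>\<close>.
\<close>

abbreviation Contr :: "'p form \<Rightarrow> 'p form" where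
  "Contr \<phi> \<equiv> Conj \<phi> (Neg \<phi>)"

lemma P_ns_eq_if_equivalent:
  assumes "p \<in> P_ns" "\<phi> \<Turnstile>\<^sub>L \<psi>" "\<psi> \<Turnstile>\<^sub>L \<phi>"
  shows "p \<phi> = p \<psi>"
  using assms by (auto simp: P_ns_def intro: antisym)

lemma P_ns_Neg_Neg:
  assumes "p \<in> P_ns"
  shows "p (Neg (Neg \<phi>)) = p \<phi>"
  using assms by (rule P_ns_eq_if_equivalent) (simp_all add: entails_def)

lemma P_ns_Contr_Neg:
  assumes "p \<in> P_ns"
  shows "p (Contr (Neg \<phi>)) = p (Contr \<phi>)"
  using assms by (rule P_ns_eq_if_equivalent) (simp_all add: entails_def)

text \<open>
  A contradiction entails its own negation: the valuations supporting \<open>\<phi> \<and> \<not>\<phi>\<close> make \<open>\<phi>\<close> both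
  true and false, hence \<open>\<phi> \<and> \<not>\<phi>\<close> too. So iterating the construction adds nothing.
\<close>

lemma P_ns_Contr_Contr:
  assumes "p \<in> P_ns"
  shows "p (Contr (Contr \<phi>)) = p (Contr \<phi>)"
  using assms by (rule P_ns_eq_if_equivalent) (auto simp: entails_def)

text \<open>
  By inclusion-exclusion, the left-hand side below is the probability of \<open>\<phi> \<or> \<not>\<phi>\<close>. This is
  what makes the uncertainty component non-negative.
\<close>

lemma P_ns_excluded_middle_le_1:
  assumes "p \<in> P_ns"
  shows "p \<phi> + p (Neg \<phi>) - p (Contr \<phi>) \<le> 1"
proof -
  have "p (Contr \<phi>) + p (Disj \<phi> (Neg \<phi>)) = p \<phi> + p (Neg \<phi>)" "p (Disj \<phi> (Neg \<phi>)) \<le> 1"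
    using assms unfolding P_ns_def by blast+
  then show ?thesis by linarith
qed

lemma P_ns_Contr_le:
  assumes "p \<in> P_ns"
  shows "p (Contr \<phi>) \<le> p \<phi>" "p (Contr \<phi>) \<le> p (Neg \<phi>)"
  using assms by (auto simp: P_ns_def entails_def)

lemma tr_4_of_ns_nth:
  "tr_4_of_ns p \<phi> $ 1 = p \<phi> - p (Contr \<phi>)"
  "tr_4_of_ns p \<phi> $ 2 = p (Neg \<phi>) - p (Contr \<phi>)"
  "tr_4_of_ns p \<phi> $ 3 = 1 - p \<phi> - p (Neg \<phi>) + p (Contr \<phi>)"
  "tr_4_of_ns p \<phi> $ 4 = p (Contr \<phi>)"
  by (simp_all add: tr_4_of_ns_def vector_def)

lemma tr_ns_of_4_tr_4_of_ns: "tr_ns_of_4 (tr_4_of_ns p) = p"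
  by (simp add: tr_ns_of_4_def tr_4_of_ns_nth)

lemma tr_4_of_ns_in_P_4:
  assumes "p \<in> P_ns"
  shows "tr_4_of_ns p \<in> P_4"
proof -
  have mono: "p \<phi> \<le> p \<psi>" if "\<phi> \<Turnstile>\<^sub>L \<psi>" for \<phi> \<psi>
    using assms that by (simp add: P_ns_def)
  have incl_excl: "p (Conj \<phi> \<psi>) + p (Disj \<phi> \<psi>) = p \<phi> + p \<psi>" for \<phi> \<psi>
    using assms by (simp add: P_ns_def)
  have nonneg: "0 \<le> p \<phi>" for \<phi>
    using assms by (simp add: P_ns_def)
  have u_nonneg: "0 \<le> 1 - p \<phi> - p (Neg \<phi>) + p (Contr \<phi>)" for \<phi>
    using P_ns_excluded_middle_le_1[OF assms, of \<phi>] by linarith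
  show ?thesis
    unfolding P_4_def Let_def mem_Collect_eq tr_4_of_ns_nth
    by (intro conjI allI impI)
      (simp_all add: nonneg u_nonneg mono incl_excl P_ns_Contr_le[OF assms]
        P_ns_Neg_Neg[OF assms] P_ns_Contr_Neg[OF assms] P_ns_Contr_Contr[OF assms])
qed

text \<open>
  The bounds of a probability come from normalisation: \<open>b + c\<close> and \<open>d + u\<close> are non-negative and
  add up to one.
\<close>

lemma tr_ns_of_4_in_P_ns:
  assumes "q \<in> P_4"
  shows "tr_ns_of_4 q \<in> P_ns"
proof -
  have nonneg: "0 \<le> q \<phi> $ 1" "0 \<le> q \<phi> $ 2" "0 \<le> q \<phi> $ 3" "0 \<le> q \<phi> $ 4"
    and total: "q \<phi> $ 1 + q \<phi> $ 2 + q \<phi> $ 3 + q \<phi> $ 4 = 1" for \<phi>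
    using assms by (simp_all add: P_4_def Let_def)
  have upper: "q \<phi> $ 1 + q \<phi> $ 4 \<le> 1" for \<phi>
    using nonneg(2,3)[of \<phi>] total[of \<phi>] by linarith
  have mono: "q \<phi> $ 1 + q \<phi> $ 4 \<le> q \<psi> $ 1 + q \<psi> $ 4" if "\<phi> \<Turnstile>\<^sub>L \<psi>" for \<phi> \<psi>
    using assms that by (simp add: P_4_def Let_def)
  have incl_excl: "q \<phi> $ 1 + q \<phi> $ 4 + q \<psi> $ 1 + q \<psi> $ 4
      = q (Conj \<phi> \<psi>) $ 1 + q (Conj \<phi> \<psi>) $ 4 + q (Disj \<phi> \<psi>) $ 1 + q (Disj \<phi> \<psi>) $ 4" for \<phi> \<psi>
    using assms unfolding P_4_def Let_def by blast
  show ?thesis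
    unfolding P_ns_def tr_ns_of_4_def mem_Collect_eq
  proof (intro conjI allI impI)
    fix \<phi> \<psi>
    show "q (Conj \<phi> \<psi>) $ 1 + q (Conj \<phi> \<psi>) $ 4 + (q (Disj \<phi> \<psi>) $ 1 + q (Disj \<phi> \<psi>) $ 4)
        = q \<phi> $ 1 + q \<phi> $ 4 + (q \<psi> $ 1 + q \<psi> $ 4)"
      using incl_excl[of \<phi> \<psi>] by linarith
  qed (simp_all add: nonneg upper mono)
qed

lemma tr_4_of_ns_tr_ns_of_4:
  assumes "q \<in> P_4"
  shows "tr_4_of_ns (tr_ns_of_4 q) = q"
proof
  fix \<phi>
  have total: "q \<phi> $ 1 + q \<phi> $ 2 + q \<phi> $ 3 + q \<phi> $ 4 = 1"
    and Neg: "q (Neg \<phi>) $ 1 = q \<phi> $ 2" "q (Neg \<phi>) $ 4 = q \<phi> $ 4"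
    and Contr: "q (Contr \<phi>) $ 1 = 0" "q (Contr \<phi>) $ 4 = q \<phi> $ 4"
    using assms by (simp_all add: P_4_def Let_def)
  show "tr_4_of_ns (tr_ns_of_4 q) \<phi> = q \<phi>"
    using total
    by (simp add: vec_eq_iff forall_4 tr_4_of_ns_nth tr_ns_of_4_def Neg Contr)
qed

theorem theorem2:
  shows "(tr_ns_of_4 :: ('p::finite form \<Rightarrow> real ^ 4) \<Rightarrow> 'p form \<Rightarrow> real) \<in> P_4 \<rightarrow> P_ns
    \<and> (tr_4_of_ns :: ('p form \<Rightarrow> real) \<Rightarrow> 'p form \<Rightarrow> real ^ 4) \<in> P_ns \<rightarrow> P_4
    \<and> (\<forall>q \<in> (P_4 :: ('p form \<Rightarrow> real ^ 4) set). (tr_4_of_ns \<circ> tr_ns_of_4) q = q)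
    \<and> (\<forall>p \<in> (P_ns :: ('p form \<Rightarrow> real) set). (tr_ns_of_4 \<circ> tr_4_of_ns) p = p)"
  by (simp add: tr_ns_of_4_in_P_ns tr_4_of_ns_in_P_4 tr_4_of_ns_tr_ns_of_4 tr_ns_of_4_tr_4_of_ns)

end
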